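(* Let $X$ be a real Hilbert space and let $C$ and $D$ be nonempty closed convex cones in $X$. Then $P_C\preceq_{\mathsf{Z}}P_D$ if and only if $P_C\preceq P_D$.
   Context: $X$ is a real Hilbert space with inner product $\langle\cdot,\cdot\rangle$ and induced norm $\|\cdot\|$. For a nonempty closed convex set $C\subseteq X$, $P_C\colon X\to X$ denotes the projector (nearest point mapping) onto $C$. Zarantonello's order on projectors onto nonempty closed convex cones is $P_C\preceq_{\mathsf{Z}}P_D :\Leftrightarrow P_CP_D=P_C$ (composition of mappings). $\mathcal{F}(X)$ is the set of firmly nonexpansive mappings, i.e. $T\colon X\to X$ with $\|Tx-Ty\|^2\le\langle x-y,Tx-Ty\rangle$ for all $x,y\in X$; projectors onto nonempty closed convex sets belong to $\mathcal{F}(X)$. The resolvent order on $\mathcal{F}(X)$ is $T_1\preceq T_2 :\Leftrightarrow T_2-T_1\in\mathcal{F}(X)$. *)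

theory Defs
  imports "HOL-Analysis.Analysis"
begin

(* The library's closest_point has exactly this definition, but its class heine_borel
   restricts it to finite-dimensional spaces.  Hilbert spaces are rendered as the sort
   {real_inner, complete_space}. *)
definition projector :: "'a::real_inner set \<Rightarrow> 'a \<Rightarrow> 'a"
  where "projector C x = (SOME p. p \<in> C \<and> (\<forall>y\<in>C. dist x p \<le> dist x y))"

definition firmly_nonexpansive :: "('a::real_inner \<Rightarrow> 'a) set"
  where "firmly_nonexpansive =
    {T. \<forall>x y. (norm (T x - T y))\<^sup>2 \<le> inner (x - y) (T x - T y)}"

(* Both orders below are given by their defining formula on arbitrary mappings; they are
   meant for projectors onto nonempty closed convex cones and for members of
   firmly_nonexpansive, respectively. *)
definition zarantonello_le :: "('a \<Rightarrow> 'a) \<Rightarrow> ('a \<Rightarrow> 'a) \<Rightarrow> bool"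
  where "zarantonello_le P Q \<longleftrightarrow> P \<circ> Q = P"

definition resolvent_le :: "('a::real_inner \<Rightarrow> 'a) \<Rightarrow> ('a \<Rightarrow> 'a) \<Rightarrow> bool"
  where "resolvent_le T1 T2 \<longleftrightarrow> (\<lambda>x. T2 x - T1 x) \<in> firmly_nonexpansive"

lemma nearest_point_exists:
  fixes C :: "'a::{real_inner,complete_space} set"
  assumes "C \<noteq> {}" "closed C" "convex C"
  shows "\<exists>p\<in>C. \<forall>y\<in>C. dist x p \<le> dist x y"
proof -
  define q where "q y = (norm (x - y))\<^sup>2" for y
  define d where "d = (INF y\<in>C. q y)"
  have bdd: "bdd_below (q ` C)"
    by (rule bdd_belowI2[of _ 0]) (simp add: q_def)
  have lower: "d \<le> q y" if "y \<in> C" for y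
    unfolding d_def using bdd that by (rule cINF_lower)
  have "\<exists>y\<in>C. q y < d + 1 / Suc n" for n
    using cINF_less_iff[OF assms(1) bdd, of "d + 1 / Suc n"] by (simp add: d_def)
  then obtain s where s: "\<And>n. s n \<in> C" "\<And>n. q (s n) < d + 1 / Suc n"
    by metis
  have gap: "(dist (s m) (s n))\<^sup>2 \<le> 2 / Suc m + 2 / Suc n" for m n
  proof -
    have "midpoint (s m) (s n) \<in> C"
      using s(1) assms(3) midpoint_in_closed_segment[of "s m" "s n"]
      unfolding convex_contains_segment by blast
    then have "d \<le> q (midpoint (s m) (s n))" by (rule lower)
    moreover have "(dist (s m) (s n))\<^sup>2 = 2 * q (s m) + 2 * q (s n) - 4 * q (midpoint (s m) (s n))"
      by (simp add: q_def midpoint_def dist_norm power2_norm_eq_inner inner_commute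
          algebra_simps)
    ultimately show ?thesis using s(2)[of m] s(2)[of n] by simp
  qed
  have "Cauchy s"
  proof (rule metric_CauchyI)
    fix e :: real assume e: "0 < e"
    then obtain N where N: "1 / real (Suc N) < e\<^sup>2 / 4"
      using nat_approx_posE[of "e\<^sup>2 / 4"] by auto
    have "dist (s m) (s n) < e" if "m \<ge> N" "n \<ge> N" for m n
    proof -
      have "1 / real (Suc m) \<le> 1 / Suc N" "1 / real (Suc n) \<le> 1 / Suc N"
        using that by (simp_all add: frac_le)
      then have "(dist (s m) (s n))\<^sup>2 < e\<^sup>2" using gap[of m n] N by simp
      then show ?thesis using e by (simp add: power_less_imp_less_base)
    qed
    then show "\<exists>M. \<forall>m\<ge>M. \<forall>n\<ge>M. dist (s m) (s n) < e" by blast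
  qed
  then obtain l where l: "s \<longlonglongrightarrow> l"
    using Cauchy_convergent convergent_def by blast
  have "l \<in> C" using closed_sequentially[OF assms(2)] s(1) l by blast
  have "(\<lambda>n. q (s n)) \<longlonglongrightarrow> q l" unfolding q_def by (intro tendsto_intros l)
  moreover have "(\<lambda>n. d + 1 / Suc n) \<longlonglongrightarrow> d + 0"
    by (rule tendsto_add[OF tendsto_const LIMSEQ_Suc[OF lim_1_over_n]])
  ultimately have "q l \<le> d + 0"
    by (rule LIMSEQ_le) (use s(2) less_imp_le in blast)
  then have "q l \<le> q y" if "y \<in> C" for y
    using lower[OF that] by linarith
  then have "\<forall>y\<in>C. dist x l \<le> dist x y"
    by (simp add: q_def dist_norm power2_le_iff_abs_le)
  then show ?thesis using \<open>l \<in> C\<close> by blast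
qed

lemma
  fixes C :: "'a::{real_inner,complete_space} set"
  assumes "C \<noteq> {}" "closed C" "convex C"
  shows projector_in: "projector C x \<in> C"
    and projector_le: "y \<in> C \<Longrightarrow> dist x (projector C x) \<le> dist x y"
  using someI_ex[OF nearest_point_exists[OF assms, unfolded Bex_def], of x]
  by (auto simp: projector_def)

lemma projector_firmly_nonexpansive:
  fixes C :: "'a::{real_inner,complete_space} set"
  assumes "C \<noteq> {}" "closed C" "convex C"
  shows "projector C \<in> firmly_nonexpansive"
proof -
  have var: "inner (x - projector C x) (y - projector C x) \<le> 0" if "y \<in> C" for x y
    using any_closest_point_dot[OF assms(3,2) projector_in[OF assms] that]
      projector_le[OF assms] by blast
  have "(norm (projector C x - projector C y))\<^sup>2 \<le> inner (x - y) (projector C x - projector C y)"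
    for x y
    using var[of "projector C y" x] var[of "projector C x" y] projector_in[OF assms]
    by (simp add: power2_norm_eq_inner inner_commute algebra_simps)
  then show ?thesis by (simp add: firmly_nonexpansive_def)
qed

end

theory Submission
  imports Defs
begin

text \<open>
  Write \<open>P\<close> and \<open>Q\<close> for the projectors onto \<open>C\<close> and \<open>D\<close>.

  If \<open>Q - P\<close> is firmly nonexpansive, compare the points \<open>x\<close> and \<open>Q x\<close>. Since \<open>Q\<close> is idempotent,
  \<open>Q - P\<close> and \<open>P\<close> move by opposite vectors between these two points, while firm nonexpansiveness
  bounds the squared norm of each vector by its inner product with \<open>x - Q x\<close>. These two inner
  products sum to zero, so both vectors vanish, that is, \<open>P (Q x) = P x\<close>.

  For the converse, firm nonexpansiveness of \<open>Q - P\<close> says that increments of \<open>x - (Q x - P x)\<close> have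
  nonnegative inner product with those of \<open>Q x - P x\<close>. Split the former map as \<open>(x - Q x) + P x\<close>.
  The part coming from \<open>P x = P (Q x)\<close> is harmless because \<open>P\<close> is firmly nonexpansive at
  \<open>Q x\<close> and \<open>Q y\<close>. The part coming from \<open>x - Q x\<close>, which lies in the polar cone of \<open>D\<close> and is
  orthogonal to \<open>Q x - P x\<close>, is harmless as soon as \<open>Q y - P y\<close> lies in \<open>D\<close>. So the essential point
  is that \<open>P \<circ> Q = P\<close> forces \<open>d - P d \<in> D\<close> for every \<open>d \<in> D\<close>
  (\<open>zarantonello_residual_in\<close>).
\<close>

lemma projector_variational:
  fixes C :: "'a::{real_inner,complete_space} set"
  assumes "C \<noteq> {}" "closed C" "convex C" "y \<in> C"
  shows "inner (x - projector C x) (y - projector C x) \<le> 0"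
  using any_closest_point_dot[OF assms(3,2) projector_in[OF assms(1-3)] assms(4)]
    projector_le[OF assms(1-3)] by blast

lemma projector_fixes:
  fixes C :: "'a::{real_inner,complete_space} set"
  assumes "C \<noteq> {}" "closed C" "convex C" "x \<in> C"
  shows "projector C x = x"
  using projector_le[OF assms, of x] by simp

text \<open>
  The two halves of Moreau's decomposition: the residual is orthogonal to the projection and lies in
  the polar cone. Testing the variational inequality with the multiples \<open>0\<close> and \<open>2\<close> of the
  projection gives both signs of the first inner product.
\<close>

lemma projector_cone_orthogonal:
  fixes C :: "'a::{real_inner,complete_space} set"
  assumes "C \<noteq> {}" "closed C" "convex C" "cone C"
  shows "inner (x - projector C x) (projector C x) = 0"
proof -
  have "t *\<^sub>R projector C x \<in> C" if "0 \<le> t" for t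
    using mem_cone[OF assms(4) projector_in[OF assms(1-3)] that] .
  from projector_variational[OF assms(1-3) this[of 0], of x]
    projector_variational[OF assms(1-3) this[of 2], of x]
  show ?thesis by (simp add: inner_diff_right)
qed

lemma projector_cone_polar:
  fixes C :: "'a::{real_inner,complete_space} set"
  assumes "C \<noteq> {}" "closed C" "convex C" "cone C" "c \<in> C"
  shows "inner (x - projector C x) c \<le> 0"
  using projector_variational[OF assms(1-3,5), of x] projector_cone_orthogonal[OF assms(1-4), of x]
  by (simp add: inner_diff_right)

text \<open>
  The residual \<open>z = d - P d\<close> lies in the polar cone of \<open>C\<close>, so \<open>P z = 0\<close>. The hypothesis then
  transfers this to \<open>P (Q z) = 0\<close>, so \<open>Q z\<close> lies in the polar cone of \<open>C\<close> as well. This information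
  makes \<open>n = z - Q z\<close> vanish: since \<open>d = P d + Q z + n\<close> is in \<open>D\<close> and \<open>n\<close> in its polar cone,
  \<open>\<parallel>n\<parallel>\<^sup>2 \<le> - \<langle>n, P d\<rangle> = \<langle>Q z, P d\<rangle> \<le> 0\<close>.
\<close>

lemma zarantonello_residual_in:
  fixes C D :: "'a::{real_inner,complete_space} set"
  assumes C: "C \<noteq> {}" "closed C" "convex C" "cone C"
    and D: "D \<noteq> {}" "closed D" "convex D" "cone D"
    and PQ: "\<And>x. projector C (projector D x) = projector C x"
    and d: "d \<in> D"
  shows "d - projector C d \<in> D"
proof -
  define c where "c = projector C d"
  define z where "z = d - c"
  define q where "q = projector D z"
  define n where "n = z - q"
  have cC: "c \<in> C" unfolding c_def by (rule projector_in[OF C(1-3)])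
  have zc: "inner z c = 0"
    unfolding z_def c_def by (rule projector_cone_orthogonal[OF C])
  have "inner z (projector C z) \<le> 0"
    using projector_cone_polar[OF C projector_in[OF C(1-3)], of d z] by (simp add: z_def c_def)
  then have "inner (projector C z) (projector C z) \<le> 0"
    using projector_cone_orthogonal[OF C, of z] by (simp add: inner_diff_left)
  then have "projector C z = 0"
    using inner_ge_zero[of "projector C z"] inner_eq_zero_iff by fastforce
  then have "projector C q = 0"
    using PQ by (simp add: q_def)
  then have qc: "inner q c \<le> 0"
    using projector_cone_polar[OF C cC, of q] by simp
  have nd: "inner n d \<le> 0"
    unfolding n_def q_def by (rule projector_cone_polar[OF D d])
  have nq: "inner n q = 0"
    unfolding n_def q_def by (rule projector_cone_orthogonal[OF D])
  have "d = q + n + c" by (simp add: n_def z_def)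
  then have "inner n n + inner n c \<le> 0"
    using nd nq by (simp add: inner_add_right)
  moreover have "inner n c = - inner q c"
    using zc by (simp add: n_def inner_diff_left)
  ultimately have "inner n n \<le> 0" using qc by linarith
  then have "n = 0"
    using inner_ge_zero[of n] inner_eq_zero_iff by fastforce
  then have "z = q" by (simp add: n_def)
  then show ?thesis
    using projector_in[OF D(1-3), of z] by (simp add: q_def z_def c_def)
qed

lemma resolvent_le_if_zarantonello_le:
  fixes C D :: "'a::{real_inner,complete_space} set"
  assumes C: "C \<noteq> {}" "closed C" "convex C" "cone C"
    and D: "D \<noteq> {}" "closed D" "convex D" "cone D"
    and le: "zarantonello_le (projector C) (projector D)"
  shows "resolvent_le (projector C) (projector D)"
proof -
  let ?P = "projector C" and ?Q = "projector D"
  let ?R = "\<lambda>x. ?Q x - ?P x"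
  have PQ: "?P (?Q x) = ?P x" for x
    using le by (metis zarantonello_le_def comp_apply)
  have QD: "?Q x \<in> D" for x by (rule projector_in[OF D(1-3)])
  have residual_D: "?R y \<in> D" for y
    using zarantonello_residual_in[OF C D PQ QD[of y]] by (simp add: PQ)
  have orth: "inner (x - ?Q x) (?R x) = 0" for x
  proof -
    have "inner (x - ?P x) (?P x) = 0" "inner (?Q x - ?P x) (?P x) = 0"
      using projector_cone_orthogonal[OF C, of x] projector_cone_orthogonal[OF C, of "?Q x"]
      by (simp_all add: PQ)
    then have "inner (x - ?Q x) (?P x) = 0"
      by (simp add: inner_diff_left)
    then show ?thesis
      using projector_cone_orthogonal[OF D, of x] by (simp add: inner_diff_right)
  qed
  have mono_Q: "inner (x - ?Q x) (?R x - ?R y) \<ge> 0" for x y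
    using orth[of x] projector_cone_polar[OF D residual_D, of x y]
    by (simp add: inner_diff_right)
  have "(norm (?R x - ?R y))\<^sup>2 \<le> inner (x - y) (?R x - ?R y)" for x y
  proof -
    have "(norm (?P x - ?P y))\<^sup>2 \<le> inner (?Q x - ?Q y) (?P x - ?P y)"
      using projector_firmly_nonexpansive[OF C(1-3)] PQ
      by (simp add: firmly_nonexpansive_def) metis
    then have "inner (?P x - ?P y) (?R x - ?R y) \<ge> 0"
      by (simp add: power2_norm_eq_inner inner_commute algebra_simps)
    moreover have "inner (x - y) (?R x - ?R y) - (norm (?R x - ?R y))\<^sup>2
      = inner (x - ?Q x) (?R x - ?R y) + inner (y - ?Q y) (?R y - ?R x)
        + inner (?P x - ?P y) (?R x - ?R y)"
      by (simp add: power2_norm_eq_inner inner_commute algebra_simps)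
    ultimately show ?thesis using mono_Q[of x y] mono_Q[of y x] by linarith
  qed
  then show ?thesis by (simp add: resolvent_le_def firmly_nonexpansive_def)
qed

text \<open>
  Between \<open>x\<close> and \<open>Q x\<close> the increments of \<open>Q - P\<close> and of \<open>P\<close> are opposite, so adding the two firm
  nonexpansiveness inequalities cancels the inner products and leaves only the squared norms.
\<close>

lemma zarantonello_le_if_resolvent_le:
  fixes C D :: "'a::{real_inner,complete_space} set"
  assumes C: "C \<noteq> {}" "closed C" "convex C"
    and D: "D \<noteq> {}" "closed D" "convex D"
    and le: "resolvent_le (projector C) (projector D)"
  shows "zarantonello_le (projector C) (projector D)"
proof -
  let ?P = "projector C" and ?Q = "projector D"
  have "?P (?Q x) = ?P x" for x
  proof -
    define u where "u = ?P x - ?P (?Q x)"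
    have idem: "?Q (?Q x) = ?Q x"
      by (rule projector_fixes[OF D projector_in[OF D]])
    have FNE: "(norm ((?Q x - ?P x) - (?Q y - ?P y)))\<^sup>2
        \<le> inner (x - y) ((?Q x - ?P x) - (?Q y - ?P y))" for y
      using le by (simp add: resolvent_le_def firmly_nonexpansive_def)
    have "(norm u)\<^sup>2 \<le> - inner (x - ?Q x) u"
      using FNE[of "?Q x"] idem by (simp add: u_def norm_minus_commute inner_diff_right)
    moreover have "(norm u)\<^sup>2 \<le> inner (x - ?Q x) u"
      using projector_firmly_nonexpansive[OF C] by (simp add: firmly_nonexpansive_def u_def)
    ultimately have "(norm u)\<^sup>2 \<le> 0" by linarith
    then show ?thesis by (simp add: u_def)
  qed
  then show ?thesis by (auto simp: zarantonello_le_def)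
qed

theorem lemma5p3:
  fixes C D :: "'a::{real_inner,complete_space} set"
  assumes "C \<noteq> {}" "closed C" "convex C" "cone C"
    and "D \<noteq> {}" "closed D" "convex D" "cone D"
  shows "zarantonello_le (projector C) (projector D) \<longleftrightarrow>
         resolvent_le (projector C) (projector D)"
  using resolvent_le_if_zarantonello_le[OF assms] zarantonello_le_if_resolvent_le[OF assms(1-3,5-7)]
  by blast

end
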